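(* There is a function $\varepsilon:(e,\infty)\to\mathbb{R}$ with $\varepsilon(x)\to 0$ as $x\to\infty$ such that the following holds. For all real numbers $Q,Q'\ge 1$ with $QQ'>e$ and all sets $A,B\subseteq \mathcal F_{Q,Q'}$, $$|A/B|\ge |A||B|\exp\left(-\bigl(2\sqrt{\log 2}+\varepsilon(QQ')\bigr)\frac{\log(QQ')}{\sqrt{\log\log(QQ')}}\right).$$
   Context: For real numbers $Q,Q'\ge 1$, $\mathcal F_{Q,Q'}=\{q/q' : q,q'\in\mathbb{Z},\ 1\le q\le Q,\ 1\le q'\le Q'\}$, a set of positive rational numbers. For sets $A,B$ of positive rationals, $A/B=\{a/b: a\in A,\ b\in B\}$. $\log$ denotes the natural logarithm. *)

theory Defs
  imports Complex_Main
begin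

definition farey_like :: "real \<Rightarrow> real \<Rightarrow> rat set" where
  "farey_like Q Q' = {of_int q / of_int q' | q q'. (1::int) \<le> q \<and> real_of_int q \<le> Q
                                              \<and> (1::int) \<le> q' \<and> real_of_int q' \<le> Q'}"

definition quot_set :: "rat set \<Rightarrow> rat set \<Rightarrow> rat set" where
  "quot_set A B = {a / b | a b. a \<in> A \<and> b \<in> B}"

end

theory Submission
  imports Defs "HOL-Computational_Algebra.Primes" "HOL-Real_Asymp.Real_Asymp"
begin

text \<open>
  Identify a positive rational with its vector of \<open>p\<close>-adic valuations, so that \<open>A/B\<close> becomes a
  difference set in a free abelian group. In the style of the Prekopa-Leindler inequality, call
  a weight \<open>w\<close> on the integers admissible if \<open>F k * G l \<le> H (k - l)\<close> forces
  \<open>(\<Sum>k. F k * w k) * (\<Sum>l. G l * w l) \<le> (\<Sum>n. H n)\<close>. This property tensorizes, so admissible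
  weights \<open>w p\<close> give \<open>(\<Sum>a\<in>A. \<Prod>p. w p (v p a)) * (\<Sum>b\<in>B. \<Prod>p. w p (v p b)) \<le> |A/B|\<close>.
  The weight \<open>c ^ |k|\<close> is admissible for \<open>c \<le> 1/3\<close>, and for every \<open>c < 1\<close> after multiplication by
  \<open>sqrt ((1 - c) / (1 + c))\<close>. With \<open>c = p powr - \<delta>\<close> the product of the weights at \<open>q/q'\<close> is at
  least \<open>(Q * Q') powr - \<delta>\<close>, up to the scaling factors of the primes with \<open>p powr - \<delta> > 1/3\<close>.
  For \<open>\<delta> = 2 * ln 3 / ln (ln (Q * Q'))\<close> these are primes below \<open>sqrt (ln (Q * Q'))\<close>, and the total
  loss is \<open>exp (O(ln (Q * Q') / ln (ln (Q * Q'))))\<close>.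
\<close>

section \<open>Admissible weights on the integers\<close>

text \<open>Arbitrary nonnegative \<open>F\<close> and \<open>G\<close>, rather than indicator
  functions, are what makes the property tensorize: in the induction over primes they become
  weighted sizes of fibres. The sum of \<open>H\<close> runs over the difference set only, so
  \<open>H\<close> is never constrained elsewhere.\<close>

definition difference_weight :: "(int \<Rightarrow> real) \<Rightarrow> bool" where
  "difference_weight w \<longleftrightarrow> (\<forall>k. 0 \<le> w k) \<and>
     (\<forall>K L F G H. finite K \<longrightarrow> finite L \<longrightarrow> (\<forall>k\<in>K. 0 \<le> F k) \<longrightarrow> (\<forall>l\<in>L. 0 \<le> G l) \<longrightarrow>
        (\<forall>k\<in>K. \<forall>l\<in>L. F k * G l \<le> H (k - l)) \<longrightarrow>
        (\<Sum>k\<in>K. F k * w k) * (\<Sum>l\<in>L. G l * w l) \<le> (\<Sum>n\<in>(\<lambda>(k, l). k - l) ` (K \<times> L). (H n :: real)))"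

lemma sum_power_nat_le:
  fixes c :: real
  assumes "finite J" "0 \<le> c" "c < 1"
  shows "(\<Sum>j\<in>J. c ^ j) \<le> 1 / (1 - c)"
proof -
  have "(\<Sum>j\<in>J. c ^ j) \<le> (\<Sum>j. c ^ j)"
    using assms by (intro sum_le_suminf summable_geometric) auto
  also have "\<dots> = 1 / (1 - c)"
    using assms by (intro suminf_geometric) auto
  finally show ?thesis .
qed

text \<open>The bound is the full two-sided series: \<open>1 / (1 - c)\<close> from
  \<open>k \<ge> 0\<close> and \<open>c / (1 - c)\<close> from \<open>k < 0\<close>.\<close>

lemma sum_power_abs_le:
  fixes c :: real
  assumes "finite K" "0 \<le> c" "c < 1"
  shows "(\<Sum>k\<in>K. c ^ nat \<bar>k\<bar>) \<le> (1 + c) / (1 - c)"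
proof -
  let ?P = "{k\<in>K. 0 \<le> k}" and ?N = "{k\<in>K. k < 0}"
  have K: "K = ?P \<union> ?N" by auto
  have "(\<Sum>k\<in>?P. c ^ nat \<bar>k\<bar>) = (\<Sum>j\<in>nat ` ?P. c ^ j)"
    by (subst sum.reindex) (auto simp: inj_on_def intro!: sum.cong)
  also have "\<dots> \<le> 1 / (1 - c)"
    using assms by (intro sum_power_nat_le) auto
  finally have P: "(\<Sum>k\<in>?P. c ^ nat \<bar>k\<bar>) \<le> 1 / (1 - c)" .
  have "(\<Sum>k\<in>?N. c ^ nat \<bar>k\<bar>) = c * (\<Sum>k\<in>?N. c ^ nat (- k - 1))"
    unfolding sum_distrib_left
  proof (rule sum.cong[OF refl])
    fix k assume "k \<in> ?N"
    then have "nat \<bar>k\<bar> = Suc (nat (- k - 1))" by auto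
    then show "c ^ nat \<bar>k\<bar> = c * c ^ nat (- k - 1)" by simp
  qed
  also have "(\<Sum>k\<in>?N. c ^ nat (- k - 1)) = (\<Sum>j\<in>(\<lambda>k. nat (- k - 1)) ` ?N. c ^ j)"
    by (subst sum.reindex) (auto simp: inj_on_def)
  also have "c * \<dots> \<le> c * (1 / (1 - c))"
    using assms by (intro mult_left_mono sum_power_nat_le) auto
  finally have N: "(\<Sum>k\<in>?N. c ^ nat \<bar>k\<bar>) \<le> c * (1 / (1 - c))" .
  have "(\<Sum>k\<in>K. c ^ nat \<bar>k\<bar>) = (\<Sum>k\<in>?P. c ^ nat \<bar>k\<bar>) + (\<Sum>k\<in>?N. c ^ nat \<bar>k\<bar>)"
    by (subst K, rule sum.union_disjoint) (use assms in auto)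
  also have "\<dots> \<le> 1 / (1 - c) + c * (1 / (1 - c))"
    using P N by simp
  also have "\<dots> = (1 + c) / (1 - c)"
    by (simp add: add_divide_distrib)
  finally show ?thesis .
qed

text \<open>Here \<open>m\<close>, \<open>n\<close> stand for the maxima of \<open>F\<close>,
  \<open>G\<close>, then \<open>X\<close>, \<open>Y\<close> for their sums, \<open>U\<close>,
  \<open>V\<close> for their weighted sums and \<open>S\<close> for the sum of \<open>H\<close>.
  Since \<open>c \<le> 1/3\<close>, each of the corrections \<open>n * c * (X - m)\<close> and
  \<open>m * c * (Y - n)\<close> costs at most a third of \<open>S - m * n\<close>. The worst case
  uses one copy of the first and two of the second, which fill \<open>S - m * n\<close>
  exactly.\<close>

lemma two_sum_bound:
  fixes c m n U V X Y :: real
  assumes c: "0 \<le> c" "c \<le> 1/3" and mn: "0 \<le> m" "0 \<le> n" "m \<le> X" "n \<le> Y"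
    and U: "0 \<le> U" "U \<le> m + c * (X - m)" "U \<le> 2 * m"
    and V: "0 \<le> V" "V \<le> n + c * (Y - n)" "V \<le> 2 * n"
    and S: "n * X \<le> S" "m * Y \<le> S"
  shows "U * V \<le> S"
proof -
  have dX: "n * (c * (X - m)) \<le> (S - m * n) / 3"
  proof -
    have "c * (n * (X - m)) \<le> (1/3) * (n * (X - m))"
      using c mn by (intro mult_right_mono) auto
    then show ?thesis using S by (simp add: algebra_simps)
  qed
  have dY: "m * (c * (Y - n)) \<le> (S - m * n) / 3"
  proof -
    have "c * (m * (Y - n)) \<le> (1/3) * (m * (Y - n))"
      using c mn by (intro mult_right_mono) auto
    then show ?thesis using S by (simp add: algebra_simps)
  qed
  have mnS: "m * n \<le> S"
    using S(2) mult_left_mono[OF mn(4) mn(1)] by simp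
  show ?thesis
  proof (cases "V \<le> n")
    case True
    then have "U * V \<le> (m + c * (X - m)) * n"
      using U V mn by (intro mult_mono) auto
    then show ?thesis using dX mnS by (simp add: algebra_simps)
  next
    case False
    \<comment> \<open>The linear bound on \<open>U\<close> is used against \<open>n\<close>, the
      cruder \<open>U \<le> 2 * m\<close> only against the excess \<open>V - n\<close>; this avoids
      a product of the two corrections.\<close>
    have "U * V = U * n + U * (V - n)" by (simp add: algebra_simps)
    also have "U * n \<le> (m + c * (X - m)) * n"
      using U mn by (intro mult_right_mono) auto
    also have "U * (V - n) \<le> (2 * m) * (c * (Y - n))"
      using U V mn False by (intro mult_mono) auto
    also have "(m + c * (X - m)) * n + 2 * m * (c * (Y - n)) = m * n + n * (c * (X - m)) + 2 * (m * (c * (Y - n)))"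
      by (simp add: algebra_simps)
    also have "\<dots> \<le> m * n + (S - m * n) / 3 + 2 * ((S - m * n) / 3)"
      by (rule add_mono[OF add_left_mono[OF dX] mult_left_mono[OF dY]]) simp
    finally show ?thesis by (simp add: field_simps)
  qed
qed

lemma sum_difference_ge:
  fixes F G H :: "int \<Rightarrow> real"
  assumes fin: "finite K" "finite L" and F: "\<forall>k\<in>K. 0 \<le> F k" and G: "\<forall>l\<in>L. 0 \<le> G l"
    and H: "\<forall>k\<in>K. \<forall>l\<in>L. F k * G l \<le> H (k - l)"
  shows "l0 \<in> L \<Longrightarrow> G l0 * (\<Sum>k\<in>K. F k) \<le> (\<Sum>n\<in>(\<lambda>(k, l). k - l) ` (K \<times> L). H n)"
    and "k0 \<in> K \<Longrightarrow> F k0 * (\<Sum>l\<in>L. G l) \<le> (\<Sum>n\<in>(\<lambda>(k, l). k - l) ` (K \<times> L). H n)"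
proof -
  have nonneg: "0 \<le> H n" if "n \<in> (\<lambda>(k, l). k - l) ` (K \<times> L)" for n
    using that F G H by (auto intro: order_trans[OF mult_nonneg_nonneg])
  show "G l0 * (\<Sum>k\<in>K. F k) \<le> (\<Sum>n\<in>(\<lambda>(k, l). k - l) ` (K \<times> L). H n)" if "l0 \<in> L"
  proof -
    have "G l0 * (\<Sum>k\<in>K. F k) \<le> (\<Sum>k\<in>K. H (k - l0))"
      unfolding sum_distrib_left using H that by (intro sum_mono) (auto simp: mult.commute)
    also have "\<dots> = (\<Sum>n\<in>(\<lambda>k. k - l0) ` K. H n)"
      by (subst sum.reindex) (auto simp: inj_on_def)
    also have "\<dots> \<le> (\<Sum>n\<in>(\<lambda>(k, l). k - l) ` (K \<times> L). H n)"
      using fin that nonneg by (intro sum_mono2) auto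
    finally show ?thesis .
  qed
  show "F k0 * (\<Sum>l\<in>L. G l) \<le> (\<Sum>n\<in>(\<lambda>(k, l). k - l) ` (K \<times> L). H n)" if "k0 \<in> K"
  proof -
    have "F k0 * (\<Sum>l\<in>L. G l) \<le> (\<Sum>l\<in>L. H (k0 - l))"
      unfolding sum_distrib_left using H that by (intro sum_mono) auto
    also have "\<dots> = (\<Sum>n\<in>(\<lambda>l. k0 - l) ` L. H n)"
      by (subst sum.reindex) (auto simp: inj_on_def)
    also have "\<dots> \<le> (\<Sum>n\<in>(\<lambda>(k, l). k - l) ` (K \<times> L). H n)"
      using fin that nonneg by (intro sum_mono2) auto
    finally show ?thesis .
  qed
qed

lemma weighted_sum_le:
  fixes F :: "int \<Rightarrow> real" and c m :: real
  assumes fin: "finite K" and F: "\<forall>k\<in>K. F k \<le> m" and c: "0 \<le> c" "c < 1" and m: "0 \<le> m"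
  shows "(\<Sum>k\<in>K. F k * c ^ nat \<bar>k\<bar>) \<le> m * ((1 + c) / (1 - c))"
proof -
  have "(\<Sum>k\<in>K. F k * c ^ nat \<bar>k\<bar>) \<le> (\<Sum>k\<in>K. m * c ^ nat \<bar>k\<bar>)"
    using F c by (intro sum_mono mult_right_mono) auto
  also have "\<dots> = m * (\<Sum>k\<in>K. c ^ nat \<bar>k\<bar>)" by (simp add: sum_distrib_left)
  also have "\<dots> \<le> m * ((1 + c) / (1 - c))"
    using sum_power_abs_le[OF fin c] m by (intro mult_left_mono)
  finally show ?thesis .
qed

text \<open>Only \<open>k = 0\<close> has weight 1, and every other weight is at most
  \<open>c\<close>. So the sum is at most \<open>c\<close> times the total plus
  \<open>(1 - c) * F 0\<close>, where \<open>F 0 \<le> m\<close> if 0 lies in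
  \<open>K\<close>.\<close>

lemma weighted_sum_le':
  fixes F :: "int \<Rightarrow> real" and c m :: real
  assumes fin: "finite K" and F: "\<forall>k\<in>K. 0 \<le> F k \<and> F k \<le> m" and c: "0 \<le> c" "c < 1" and m: "0 \<le> m"
  shows "(\<Sum>k\<in>K. F k * c ^ nat \<bar>k\<bar>) \<le> m + c * ((\<Sum>k\<in>K. F k) - m)"
proof -
  have "(\<Sum>k\<in>K. F k * c ^ nat \<bar>k\<bar>) \<le> (\<Sum>k\<in>K. c * F k + (if k = 0 then (1 - c) * F k else 0))"
  proof (rule sum_mono)
    fix k assume k: "k \<in> K"
    show "F k * c ^ nat \<bar>k\<bar> \<le> c * F k + (if k = 0 then (1 - c) * F k else 0)"
    proof (cases "k = 0")
      case False
      then have "c ^ nat \<bar>k\<bar> \<le> c ^ 1"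
        using c by (intro power_decreasing) auto
      then have "F k * c ^ nat \<bar>k\<bar> \<le> F k * c"
        using k F by (intro mult_left_mono) auto
      then show ?thesis using False by (simp add: mult.commute)
    qed (simp add: algebra_simps)
  qed
  also have "\<dots> = c * (\<Sum>k\<in>K. F k) + (if 0 \<in> K then (1 - c) * F 0 else 0)"
    using fin by (simp add: sum.distrib sum_distrib_left)
  also have "(if 0 \<in> K then (1 - c) * F 0 else 0) \<le> (1 - c) * m"
    using F c m by (auto intro: mult_left_mono)
  finally show ?thesis by (simp add: algebra_simps)
qed

lemma difference_weight_power:
  fixes c :: real
  assumes c: "0 \<le> c" "c \<le> 1/3"
  shows "difference_weight (\<lambda>k. c ^ nat \<bar>k\<bar>)"
  unfolding difference_weight_def
proof (intro conjI allI impI)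
  fix K L :: "int set" and F G H :: "int \<Rightarrow> real"
  assume fin: "finite K" "finite L" and F: "\<forall>k\<in>K. 0 \<le> F k" and G: "\<forall>l\<in>L. 0 \<le> G l"
    and H: "\<forall>k\<in>K. \<forall>l\<in>L. F k * G l \<le> H (k - l)"
  let ?S = "\<Sum>n\<in>(\<lambda>(k, l). k - l) ` (K \<times> L). H n"
  show "(\<Sum>k\<in>K. F k * c ^ nat \<bar>k\<bar>) * (\<Sum>l\<in>L. G l * c ^ nat \<bar>l\<bar>) \<le> ?S"
  proof (cases "K = {} \<or> L = {}")
    case False
    obtain k0 where k0: "k0 \<in> K" "\<forall>k\<in>K. F k \<le> F k0"
      using obtains_MAX[of K F] False fin by (metis Max_ge finite_imageI imageI)
    obtain l0 where l0: "l0 \<in> L" "\<forall>l\<in>L. G l \<le> G l0"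
      using obtains_MAX[of L G] False fin by (metis Max_ge finite_imageI imageI)
    \<comment> \<open>This is where \<open>c \<le> 1/3\<close> gives the factor 2 that
      \<open>two_sum_bound\<close> requires.\<close>
    have D: "(1 + c) / (1 - c) \<le> 2" using c by (simp add: field_simps)
    have c1: "c < 1" using c by simp
    show ?thesis
    proof (rule two_sum_bound[OF c])
      show "0 \<le> F k0" "0 \<le> G l0" using F G k0 l0 by auto
      show "F k0 \<le> (\<Sum>k\<in>K. F k)" "G l0 \<le> (\<Sum>l\<in>L. G l)"
        using F G k0 l0 fin by (auto intro: member_le_sum)
      show "0 \<le> (\<Sum>k\<in>K. F k * c ^ nat \<bar>k\<bar>)" "0 \<le> (\<Sum>l\<in>L. G l * c ^ nat \<bar>l\<bar>)"
        using F G c by (auto intro!: sum_nonneg)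
      show "(\<Sum>k\<in>K. F k * c ^ nat \<bar>k\<bar>) \<le> F k0 + c * ((\<Sum>k\<in>K. F k) - F k0)"
        using F k0 c c1 fin by (intro weighted_sum_le') auto
      show "(\<Sum>l\<in>L. G l * c ^ nat \<bar>l\<bar>) \<le> G l0 + c * ((\<Sum>l\<in>L. G l) - G l0)"
        using G l0 c c1 fin by (intro weighted_sum_le') auto
      have "(\<Sum>k\<in>K. F k * c ^ nat \<bar>k\<bar>) \<le> F k0 * ((1 + c) / (1 - c))"
        using F k0 c c1 fin by (intro weighted_sum_le) auto
      also have "\<dots> \<le> F k0 * 2" using D F k0 by (intro mult_left_mono) auto
      finally show "(\<Sum>k\<in>K. F k * c ^ nat \<bar>k\<bar>) \<le> 2 * F k0" by simp
      have "(\<Sum>l\<in>L. G l * c ^ nat \<bar>l\<bar>) \<le> G l0 * ((1 + c) / (1 - c))"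
        using G l0 c c1 fin by (intro weighted_sum_le) auto
      also have "\<dots> \<le> G l0 * 2" using D G l0 by (intro mult_left_mono) auto
      finally show "(\<Sum>l\<in>L. G l * c ^ nat \<bar>l\<bar>) \<le> 2 * G l0" by simp
      show "G l0 * (\<Sum>k\<in>K. F k) \<le> ?S" "F k0 * (\<Sum>l\<in>L. G l) \<le> ?S"
        using sum_difference_ge[OF fin F G H] k0 l0 by auto
    qed
  qed auto
qed (use c in auto)

text \<open>A lossy argument suffices: the weights on \<open>F\<close> are bounded by 1,
  \<open>G\<close> is bounded by its maximum, and \<open>C\<^sup>2\<close> absorbs the series
  \<open>(1 + c) / (1 - c)\<close> that this leaves.\<close>

lemma difference_weight_scaled_power:
  fixes c C :: real
  assumes c: "0 \<le> c" "c < 1" and C: "0 \<le> C" "C\<^sup>2 * ((1 + c) / (1 - c)) \<le> 1"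
  shows "difference_weight (\<lambda>k. C * c ^ nat \<bar>k\<bar>)"
  unfolding difference_weight_def
proof (intro conjI allI impI)
  fix K L :: "int set" and F G H :: "int \<Rightarrow> real"
  assume fin: "finite K" "finite L" and F: "\<forall>k\<in>K. 0 \<le> F k" and G: "\<forall>l\<in>L. 0 \<le> G l"
    and H: "\<forall>k\<in>K. \<forall>l\<in>L. F k * G l \<le> H (k - l)"
  let ?S = "\<Sum>n\<in>(\<lambda>(k, l). k - l) ` (K \<times> L). H n"
  show "(\<Sum>k\<in>K. F k * (C * c ^ nat \<bar>k\<bar>)) * (\<Sum>l\<in>L. G l * (C * c ^ nat \<bar>l\<bar>)) \<le> ?S"
  proof (cases "L = {}")
    case False
    obtain l0 where l0: "l0 \<in> L" "\<forall>l\<in>L. G l \<le> G l0"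
      using obtains_MAX[of L G] False fin by (metis Max_ge finite_imageI imageI)
    have "(\<Sum>k\<in>K. F k * (C * c ^ nat \<bar>k\<bar>)) * (\<Sum>l\<in>L. G l * (C * c ^ nat \<bar>l\<bar>)) =
        C\<^sup>2 * ((\<Sum>k\<in>K. F k * c ^ nat \<bar>k\<bar>) * (\<Sum>l\<in>L. G l * c ^ nat \<bar>l\<bar>))"
      by (simp add: mult.left_commute[of _ C] sum_distrib_left[symmetric] power2_eq_square)
    also have "\<dots> \<le> C\<^sup>2 * ((\<Sum>k\<in>K. F k) * (G l0 * ((1 + c) / (1 - c))))"
    proof (intro mult_left_mono mult_mono)
      show "(\<Sum>k\<in>K. F k * c ^ nat \<bar>k\<bar>) \<le> (\<Sum>k\<in>K. F k)"
        using F c by (intro sum_mono mult_left_le) (auto intro: power_le_one)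
      show "(\<Sum>l\<in>L. G l * c ^ nat \<bar>l\<bar>) \<le> G l0 * ((1 + c) / (1 - c))"
        using G l0 c fin by (intro weighted_sum_le) auto
    qed (use F G c in \<open>auto intro!: sum_nonneg\<close>)
    also have "\<dots> = (C\<^sup>2 * ((1 + c) / (1 - c))) * (G l0 * (\<Sum>k\<in>K. F k))"
      by (simp add: mult_ac)
    also have "\<dots> \<le> 1 * (G l0 * (\<Sum>k\<in>K. F k))"
      using C(2) F G l0 by (intro mult_right_mono) (auto intro!: sum_nonneg mult_nonneg_nonneg)
    also have "\<dots> \<le> ?S"
      using sum_difference_ge(1)[OF fin F G H] l0 by simp
    finally show ?thesis .
  qed auto
qed (use c C in auto)

section \<open>Tensorization over finitely many coordinates\<close>

lemma difference_weightD:
  assumes "difference_weight w" "finite K" "finite L" "\<forall>k\<in>K. 0 \<le> F k" "\<forall>l\<in>L. 0 \<le> G l"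
    "\<forall>k\<in>K. \<forall>l\<in>L. F k * G l \<le> H (k - l)"
  shows "(\<Sum>k\<in>K. F k * w k) * (\<Sum>l\<in>L. G l * w l) \<le> (\<Sum>n\<in>(\<lambda>(k, l). k - l) ` (K \<times> L). H n)"
  using assms unfolding difference_weight_def by blast

text \<open>Induction on \<open>P\<close>: the one-dimensional inequality is applied to the weighted sizes of the fibres of \<open>v p\<close>.\<close>
lemma weighted_card_bound:
  fixes v :: "'p \<Rightarrow> 'a :: inverse \<Rightarrow> int" and w :: "'p \<Rightarrow> int \<Rightarrow> real"
  assumes "finite P" and w: "\<forall>p\<in>P. difference_weight (w p)"
    and "finite A" "finite B"
    and hom: "\<forall>p\<in>P. \<forall>a\<in>A. \<forall>b\<in>B. v p (a / b) = v p a - v p b"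
    and "\<forall>x\<in>A. \<forall>y\<in>A. (\<forall>p\<in>P. v p x = v p y) \<longrightarrow> x = y"
    and "\<forall>x\<in>B. \<forall>y\<in>B. (\<forall>p\<in>P. v p x = v p y) \<longrightarrow> x = y"
  shows "(\<Sum>a\<in>A. \<Prod>p\<in>P. w p (v p a)) * (\<Sum>b\<in>B. \<Prod>p\<in>P. w p (v p b))
           \<le> real (card ((\<lambda>(a, b). a / b) ` (A \<times> B)))"
  using assms
proof (induction P arbitrary: A B rule: finite_induct)
  case empty
  show ?case
  proof (cases "A = {} \<or> B = {}")
    case False
    then obtain a b where "a \<in> A" "b \<in> B" by blast
    \<comment> \<open>With no coordinates left, injectivity allows only one element, and the empty
      products equal 1.\<close>
    then have "A = {a}" "B = {b}" using empty.prems by auto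
    then show ?thesis by simp
  qed auto
next
  case (insert p P)
  define Q where "Q X Y = (\<lambda>(a, b). a / b) ` (X \<times> Y)" for X Y :: "'a set"
  define W where "W x = (\<Prod>q\<in>P. w q (v q x))" for x
  define fib where "fib X k = {x\<in>X. v p x = k}" for X k
  have fin: "finite A" "finite B" by fact+
  have finQ: "finite (Q A B)" using fin by (simp add: Q_def)
  have W_nonneg: "0 \<le> W x" for x
    using insert.prems(1) by (auto simp: W_def difference_weight_def intro!: prod_nonneg)
  have split: "(\<Sum>x\<in>X. \<Prod>q\<in>insert p P. w q (v q x)) = (\<Sum>k\<in>v p ` X. (\<Sum>x\<in>fib X k. W x) * w p k)"
    if "finite X" for X
  proof -
    have "(\<Sum>x\<in>X. \<Prod>q\<in>insert p P. w q (v q x)) = (\<Sum>x\<in>X. W x * w p (v p x))"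
      using insert.hyps by (simp add: W_def mult.commute)
    also have "\<dots> = (\<Sum>k\<in>v p ` X. \<Sum>x\<in>fib X k. W x * w p (v p x))"
      unfolding fib_def using that by (rule sum.image_gen)
    also have "\<dots> = (\<Sum>k\<in>v p ` X. (\<Sum>x\<in>fib X k. W x) * w p k)"
      by (intro sum.cong refl) (auto simp: fib_def sum_distrib_right)
    finally show ?thesis .
  qed
  \<comment> \<open>\<open>F\<close> and \<open>G\<close> are the weighted fibre sizes of
    \<open>A\<close> and \<open>B\<close>, and \<open>H n\<close> is the number of quotients with
    \<open>v p\<close> equal to \<open>n\<close>.\<close>
  have "(\<Sum>k\<in>v p ` A. (\<Sum>x\<in>fib A k. W x) * w p k) * (\<Sum>k\<in>v p ` B. (\<Sum>x\<in>fib B k. W x) * w p k)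
      \<le> (\<Sum>n\<in>(\<lambda>(k, l). k - l) ` (v p ` A \<times> v p ` B). real (card (fib (Q A B) n)))"
  proof (rule difference_weightD)
    show "\<forall>k\<in>v p ` A. \<forall>l\<in>v p ` B.
        sum W (fib A k) * sum W (fib B l) \<le> real (card (fib (Q A B) (k - l)))"
    proof (intro ballI)
      fix k l
      have "sum W (fib A k) * sum W (fib B l) \<le> real (card (Q (fib A k) (fib B l)))"
        unfolding W_def Q_def
      proof (rule insert.IH)
        \<comment> \<open>On a fibre \<open>v p\<close> is constant, so the coordinates in
          \<open>P\<close> alone still separate points.\<close>
        show "\<forall>x\<in>fib A k. \<forall>y\<in>fib A k. (\<forall>p\<in>P. v p x = v p y) \<longrightarrow> x = y"
          using insert.prems(5) by (auto simp: fib_def)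
        show "\<forall>x\<in>fib B l. \<forall>y\<in>fib B l. (\<forall>p\<in>P. v p x = v p y) \<longrightarrow> x = y"
          using insert.prems(6) by (auto simp: fib_def)
      qed (use insert.prems in \<open>auto simp: fib_def\<close>)
      also have "\<dots> \<le> real (card (fib (Q A B) (k - l)))"
      proof -
        have "Q (fib A k) (fib B l) \<subseteq> fib (Q A B) (k - l)"
          using insert.prems(4) by (auto simp: Q_def fib_def)
        moreover have "finite (fib (Q A B) (k - l))"
          using finQ by (simp add: fib_def)
        ultimately show ?thesis by (simp add: card_mono)
      qed
      finally show "sum W (fib A k) * sum W (fib B l) \<le> real (card (fib (Q A B) (k - l)))" .
    qed
  qed (use insert.prems(1) fin W_nonneg in \<open>auto intro!: sum_nonneg\<close>)
  also have "(\<lambda>(k, l). k - l) ` (v p ` A \<times> v p ` B) = v p ` Q A B"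
    using insert.prems(4) by (force simp: Q_def image_iff)
  also have "(\<Sum>n\<in>v p ` Q A B. real (card (fib (Q A B) n))) = real (card (Q A B))"
    using sum.image_gen[OF finQ, of "\<lambda>_. 1 :: real" "v p"] by (simp add: fib_def)
  finally show ?case
    unfolding split[OF fin(1)] split[OF fin(2)] Q_def .
qed

section \<open>Valuations of positive rationals\<close>

text \<open>For prime \<open>p\<close> this is the \<open>p\<close>-adic valuation on positive
  rationals only, because \<open>nat\<close> sends a negative numerator to 0.\<close>

definition rat_valuation :: "nat \<Rightarrow> rat \<Rightarrow> int" where
  "rat_valuation p r = int (multiplicity p (nat (fst (quotient_of r))))
                     - int (multiplicity p (nat (snd (quotient_of r))))"

text \<open>The fraction need not be reduced: cross-multiplying with the reduced form gives
  \<open>m * nat v = nat u * n\<close>, and multiplicities add.\<close>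

lemma rat_valuation_divide:
  assumes p: "prime p" and m: "0 < m" and n: "0 < n"
  shows "rat_valuation p (of_nat m / of_nat n) = int (multiplicity p m) - int (multiplicity p n)"
proof -
  let ?r = "of_nat m / of_nat n :: rat"
  obtain u v where uv: "quotient_of ?r = (u, v)" by fastforce
  have v: "0 < v" using quotient_of_denom_pos[OF uv] .
  have r: "?r = of_int u / of_int v" using quotient_of_div[OF uv] .
  have "0 < ?r" using m n by simp
  then have u: "0 < u" using v unfolding r by (simp add: zero_less_divide_iff)
  have "(of_nat m :: rat) * of_int v = of_int u * of_nat n"
    using r v n by (simp add: frac_eq_eq)
  then have "(of_nat m :: rat) * of_nat (nat v) = of_nat (nat u) * of_nat n"
    using u v by simp
  then have eq: "m * nat v = nat u * n"
    unfolding of_nat_mult[symmetric] of_nat_eq_iff .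
  have "multiplicity p m + multiplicity p (nat v) = multiplicity p (m * nat v)"
    using p m v by (simp add: prime_elem_multiplicity_mult_distrib)
  also have "\<dots> = multiplicity p (nat u) + multiplicity p n"
    unfolding eq using p u n by (simp add: prime_elem_multiplicity_mult_distrib)
  finally show ?thesis by (simp add: rat_valuation_def uv)
qed

lemma farey_likeE:
  assumes "r \<in> farey_like Q Q'"
  obtains m n :: nat where "0 < m" "0 < n" "real m \<le> Q" "real n \<le> Q'" "r = of_nat m / of_nat n"
proof -
  obtain q q' where q: "r = of_int q / of_int q'" "1 \<le> q" "real_of_int q \<le> Q" "1 \<le> q'" "real_of_int q' \<le> Q'"
    using assms unfolding farey_like_def by blast
  show thesis
    by (rule that[of "nat q" "nat q'"]) (use q in auto)
qed

lemma prod_prime_power_multiplicity: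
  assumes "finite P" "\<forall>p\<in>P. prime p" "0 < (m :: nat)" "\<And>p. prime p \<Longrightarrow> p \<le> m \<Longrightarrow> p \<in> P"
  shows "(\<Prod>p\<in>P. p ^ multiplicity p m) = m"
proof -
  have "prime_factors m \<subseteq> P"
    using assms by (auto simp: in_prime_factors_iff dest: dvd_imp_le)
  then have "(\<Prod>p\<in>P. p ^ multiplicity p m) = (\<Prod>p\<in>prime_factors m. p ^ multiplicity p m)"
    using assms by (intro prod.mono_neutral_right)
      (auto simp: in_prime_factors_iff not_dvd_imp_multiplicity_0)
  then show ?thesis using prime_factorization_nat[of m] assms(3) by simp
qed

text \<open>The cross products \<open>m * l\<close> and \<open>k * n\<close> are compared prime by
  prime. A prime outside \<open>P\<close> exceeds both \<open>Q\<close> and \<open>Q'\<close>, hence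
  divides none of the four factors.\<close>

lemma rat_valuation_inject:
  assumes P: "\<And>p. prime p \<Longrightarrow> real p \<le> max Q Q' \<Longrightarrow> p \<in> P"
    and x: "x \<in> farey_like Q Q'" and y: "y \<in> farey_like Q Q'"
    and eq: "\<forall>p\<in>P. rat_valuation p x = rat_valuation p y"
  shows "x = y"
proof -
  obtain m n where mn: "0 < m" "0 < n" "real m \<le> Q" "real n \<le> Q'" "x = of_nat m / of_nat n"
    using x by (rule farey_likeE)
  obtain k l where kl: "0 < k" "0 < l" "real k \<le> Q" "real l \<le> Q'" "y = of_nat k / of_nat l"
    using y by (rule farey_likeE)
  have "m * l = k * n"
  proof (rule multiplicity_eq_nat)
    fix p :: nat assume p: "prime p"
    have "multiplicity p m + multiplicity p l = multiplicity p k + multiplicity p n"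
    proof (cases "p \<in> P")
      case True
      then show ?thesis using eq p mn kl by (auto simp: rat_valuation_divide)
    next
      case False
      then have "max Q Q' < real p" using P[OF p] by (meson not_le)
      then have "m < p" "n < p" "k < p" "l < p" using mn kl by auto
      then have "\<not> p dvd m" "\<not> p dvd n" "\<not> p dvd k" "\<not> p dvd l"
        using mn kl by (simp_all add: nat_dvd_not_less)
      then show ?thesis by (simp add: not_dvd_imp_multiplicity_0)
    qed
    then show "multiplicity p (m * l) = multiplicity p (k * n)"
      using p mn kl by (simp add: prime_elem_multiplicity_mult_distrib)
  qed (use mn kl in auto)
  then have "(of_nat m :: rat) * of_nat l = of_nat k * of_nat n"
    by (metis of_nat_mult)
  then show ?thesis using mn kl by (simp add: frac_eq_eq)
qed

text \<open>Cancellation between numerator and denominator only increases the product of the weights.\<close>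
lemma prod_valuation_weight_ge:
  assumes P: "finite P" "\<forall>p\<in>P. prime p" "\<And>p. prime p \<Longrightarrow> real p \<le> max Q Q' \<Longrightarrow> p \<in> P"
    and \<delta>: "0 < \<delta>" and r: "r \<in> farey_like Q Q'"
  shows "(Q * Q') powr - \<delta> \<le> (\<Prod>p\<in>P. (real p powr - \<delta>) ^ nat \<bar>rat_valuation p r\<bar>)"
proof -
  obtain m n where mn: "0 < m" "0 < n" "real m \<le> Q" "real n \<le> Q'" "r = of_nat m / of_nat n"
    using r by (rule farey_likeE)
  have "(Q * Q') powr - \<delta> \<le> (real m * real n) powr - \<delta>"
    using \<delta> mn by (intro powr_mono2' mult_mono) auto
  also have "real m * real n = (\<Prod>p\<in>P. real p ^ (multiplicity p m + multiplicity p n))"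
  proof -
    have m: "(\<Prod>p\<in>P. p ^ multiplicity p m) = m"
      using P mn by (intro prod_prime_power_multiplicity) (auto simp: le_max_iff_disj)
    have n: "(\<Prod>p\<in>P. p ^ multiplicity p n) = n"
      using P mn by (intro prod_prime_power_multiplicity) (auto simp: le_max_iff_disj)
    have "real m * real n = real ((\<Prod>p\<in>P. p ^ multiplicity p m) * (\<Prod>p\<in>P. p ^ multiplicity p n))"
      unfolding m n by simp
    also have "\<dots> = (\<Prod>p\<in>P. real p ^ (multiplicity p m + multiplicity p n))"
      by (simp add: prod.distrib power_add)
    finally show ?thesis .
  qed
  also have "\<dots> powr - \<delta> = (\<Prod>p\<in>P. (real p ^ (multiplicity p m + multiplicity p n)) powr - \<delta>)"
    by (rule prod_powr_distrib)
  also have "\<dots> \<le> (\<Prod>p\<in>P. (real p powr - \<delta>) ^ nat \<bar>rat_valuation p r\<bar>)"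
  proof (rule prod_mono)
    fix p assume p: "p \<in> P"
    then have pr: "prime p" and p1: "1 < real p" using P prime_gt_1_nat by auto
    have "(real p ^ (multiplicity p m + multiplicity p n)) powr - \<delta>
        = (real p powr - \<delta>) ^ (multiplicity p m + multiplicity p n)"
      using p1 by (simp add: powr_realpow[symmetric] powr_powr mult.commute)
    also have "\<dots> \<le> (real p powr - \<delta>) ^ nat \<bar>rat_valuation p r\<bar>"
    proof (rule power_decreasing)
      \<comment> \<open>The absolute difference of the two multiplicities is at most their
        sum.\<close>
      show "nat \<bar>rat_valuation p r\<bar> \<le> multiplicity p m + multiplicity p n"
        using pr mn by (simp add: rat_valuation_divide)
      show "real p powr - \<delta> \<le> 1"
        using p1 \<delta> by (simp add: powr_le_one_le powr_minus inverse_le_1_iff ge_one_powr_ge_zero)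
    qed auto
    finally show "0 \<le> (real p ^ (multiplicity p m + multiplicity p n)) powr - \<delta> \<and>
      (real p ^ (multiplicity p m + multiplicity p n)) powr - \<delta>
        \<le> (real p powr - \<delta>) ^ nat \<bar>rat_valuation p r\<bar>" by simp
  qed
  finally show ?thesis .
qed

section \<open>The quotient set bound with free parameters\<close>

text \<open>Primes up to \<open>y\<close> get the scaled weight and larger ones the unscaled weight.
  Every point of \<open>A\<close> and \<open>B\<close> then has weight at least \<open>D\<close>, so
  the loss is \<open>D * D\<close>.\<close>

lemma card_quot_set_ge:
  fixes \<delta> y \<kappa> :: real
  assumes \<delta>: "0 < \<delta>" and y: "0 \<le> y" and large: "\<And>p :: nat. prime p \<Longrightarrow> y < real p \<Longrightarrow> real p powr - \<delta> \<le> 1/3"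
    and \<kappa>: "\<kappa> = (1 - 2 powr - \<delta>) / (1 + 2 powr - \<delta>)"
    and fin: "finite A" "finite B" and sub: "A \<subseteq> farey_like Q Q'" "B \<subseteq> farey_like Q Q'"
  shows "real (card A) * real (card B) * (\<kappa> powr y * (Q * Q') powr (- 2 * \<delta>)) \<le> real (card (quot_set A B))"
proof -
  define P where "P = {p :: nat. prime p \<and> real p \<le> max Q Q'}"
  have "P \<subseteq> {..nat \<lfloor>max Q Q'\<rfloor>}" by (auto simp: P_def le_nat_floor)
  then have finP: "finite P" by (rule finite_subset) simp
  have c2: "2 powr - \<delta> < 1" "0 < 2 powr - \<delta>"
    using \<delta> by (auto simp: powr_less_one)
  then have \<kappa>01: "0 < \<kappa>" "\<kappa> \<le> 1"
    unfolding \<kappa> by (simp_all add: add_pos_pos divide_le_eq_1_pos)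
  \<comment> \<open>The prime 2 has the largest \<open>c\<close>, so its factor serves for all small
    primes.\<close>
  define C where "C p = (if real p \<le> y then sqrt \<kappa> else 1)" for p :: nat
  define w where "w p k = C p * (real p powr - \<delta>) ^ nat \<bar>k\<bar>" for p k
  define D where "D = \<kappa> powr (y / 2) * (Q * Q') powr - \<delta>"
  have good: "difference_weight (w p)" if p: "prime p" for p
  proof (cases "real p \<le> y")
    case True
    let ?c = "real p powr - \<delta>"
    have p2: "2 \<le> real p" using prime_ge_2_nat[OF p] by simp
    have c: "?c \<le> 2 powr - \<delta>" using p2 \<delta> by (intro powr_mono2') auto
    have "\<kappa> * ((1 + ?c) / (1 - ?c)) \<le> 1"
    proof -
      have "(1 - 2 powr - \<delta>) * (1 + ?c) \<le> (1 - ?c) * (1 + 2 powr - \<delta>)"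
        using c by (simp add: algebra_simps)
      then show ?thesis
        unfolding \<kappa> using c c2 by (simp add: divide_le_eq add_pos_pos mult.commute)
    qed
    then have "difference_weight (\<lambda>k. sqrt \<kappa> * ?c ^ nat \<bar>k\<bar>)"
      using \<kappa>01 c c2 by (intro difference_weight_scaled_power) auto
    then show ?thesis using True by (simp add: w_def[abs_def] C_def)
  next
    case False
    then show ?thesis
      using difference_weight_power[of "real p powr - \<delta>"] large[OF p]
      by (simp add: w_def[abs_def] C_def)
  qed
  have C_ge: "\<kappa> powr (y / 2) \<le> prod C P"
  proof -
    \<comment> \<open>Counting all integers from 1 to \<open>y\<close> instead of the primes is
      affordable for the later choice of \<open>y\<close>.\<close>
    have "{p\<in>P. real p \<le> y} \<subseteq> {1..nat \<lfloor>y\<rfloor>}"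
      by (auto simp: P_def le_nat_floor prime_ge_Suc_0_nat)
    then have "card {p\<in>P. real p \<le> y} \<le> nat \<lfloor>y\<rfloor>"
      using card_mono[of "{1..nat \<lfloor>y\<rfloor>}"] by fastforce
    then have n: "real (card {p\<in>P. real p \<le> y}) \<le> y"
      using y of_nat_floor[of y] by linarith
    have "\<kappa> powr (y / 2) \<le> \<kappa> powr (real (card {p\<in>P. real p \<le> y}) / 2)"
      using \<kappa>01 n by (intro powr_mono') auto
    also have "\<dots> = sqrt \<kappa> ^ card {p\<in>P. real p \<le> y}"
      using \<kappa>01 by (simp add: powr_half_sqrt[symmetric] powr_realpow[symmetric] powr_powr)
    also have "\<dots> = prod C P"
      unfolding C_def using finP by (simp add: prod.If_cases Int_def)
    finally show ?thesis .
  qed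
  have weight: "D \<le> (\<Prod>p\<in>P. w p (rat_valuation p r))" if "r \<in> farey_like Q Q'" for r
    unfolding w_def prod.distrib D_def
  proof (rule mult_mono[OF C_ge])
    show "(Q * Q') powr - \<delta> \<le> (\<Prod>p\<in>P. (real p powr - \<delta>) ^ nat \<bar>rat_valuation p r\<bar>)"
      using finP \<delta> that by (intro prod_valuation_weight_ge) (auto simp: P_def)
    show "0 \<le> prod C P" using \<kappa>01 by (intro prod_nonneg) (simp add: C_def)
  qed simp
  have hom: "rat_valuation p (a / b) = rat_valuation p a - rat_valuation p b"
    if p: "p \<in> P" and a: "a \<in> A" and b: "b \<in> B" for p a b
  proof -
    obtain m n where mn: "0 < m" "0 < n" "a = of_nat m / of_nat n"
      using farey_likeE[OF subsetD[OF sub(1) a]] by metis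
    obtain k l where kl: "0 < k" "0 < l" "b = of_nat k / of_nat l"
      using farey_likeE[OF subsetD[OF sub(2) b]] by metis
    have ab: "a / b = of_nat (m * l) / of_nat (n * k)"
      using mn kl by simp
    have pr: "prime p" using p by (simp add: P_def)
    have "rat_valuation p (a / b) = int (multiplicity p (m * l)) - int (multiplicity p (n * k))"
      unfolding ab using pr mn kl by (intro rat_valuation_divide) auto
    then show ?thesis
      unfolding mn(3) kl(3) using mn(1,2) kl(1,2) pr
      by (simp add: rat_valuation_divide prime_elem_multiplicity_mult_distrib)
  qed
  have sum_ge: "real (card X) * D \<le> (\<Sum>x\<in>X. \<Prod>p\<in>P. w p (rat_valuation p x))"
    if "X \<subseteq> farey_like Q Q'" for X
    using sum_mono[of X "\<lambda>_. D" "\<lambda>x. \<Prod>p\<in>P. w p (rat_valuation p x)"] weight that by auto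
  have D0: "0 \<le> D" by (simp add: D_def)
  have "D * D = \<kappa> powr y * (Q * Q') powr (- 2 * \<delta>)"
  proof -
    have "D * D = (\<kappa> powr (y / 2) * \<kappa> powr (y / 2)) * ((Q * Q') powr - \<delta> * (Q * Q') powr - \<delta>)"
      by (simp add: D_def mult_ac)
    then show ?thesis by (simp add: powr_add[symmetric])
  qed
  then have "real (card A) * real (card B) * (\<kappa> powr y * (Q * Q') powr (- 2 * \<delta>))
      = (real (card A) * D) * (real (card B) * D)" by (simp add: mult_ac)
  also have "\<dots> \<le> (\<Sum>x\<in>A. \<Prod>p\<in>P. w p (rat_valuation p x)) * (\<Sum>x\<in>B. \<Prod>p\<in>P. w p (rat_valuation p x))"
  proof (rule mult_mono[OF sum_ge[OF sub(1)] sum_ge[OF sub(2)]])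
    have "0 \<le> real (card A) * D" using D0 by simp
    also note sum_ge[OF sub(1)]
    finally show "0 \<le> (\<Sum>x\<in>A. \<Prod>p\<in>P. w p (rat_valuation p x))" .
  qed (use D0 in simp)
  also have "\<dots> \<le> real (card ((\<lambda>(a, b). a / b) ` (A \<times> B)))"
  proof (rule weighted_card_bound[OF finP _ fin])
    show "\<forall>p\<in>P. difference_weight (w p)" using good by (simp add: P_def)
    have inj: "x = y" if "x \<in> farey_like Q Q'" "y \<in> farey_like Q Q'"
        "\<forall>p\<in>P. rat_valuation p x = rat_valuation p y" for x y
      by (rule rat_valuation_inject[OF _ that]) (simp add: P_def)
    show "\<forall>x\<in>A. \<forall>y\<in>A. (\<forall>p\<in>P. rat_valuation p x = rat_valuation p y) \<longrightarrow> x = y"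
      using inj sub by (meson subsetD)
    show "\<forall>x\<in>B. \<forall>y\<in>B. (\<forall>p\<in>P. rat_valuation p x = rat_valuation p y) \<longrightarrow> x = y"
      using inj sub by (meson subsetD)
  qed (use hom in blast)
  also have "(\<lambda>(a, b). a / b) ` (A \<times> B) = quot_set A B"
    by (auto simp: quot_set_def)
  finally show ?thesis .
qed

section \<open>Choice of parameters and asymptotics\<close>

theorem theorem1:
  shows "\<exists>\<epsilon> :: real \<Rightarrow> real. (\<epsilon> \<longlongrightarrow> 0) at_top \<and>
     (\<forall>Q Q' :: real. \<forall>A B :: rat set.
        1 \<le> Q \<longrightarrow> 1 \<le> Q' \<longrightarrow> Q * Q' > exp 1 \<longrightarrow>
        A \<subseteq> farey_like Q Q' \<longrightarrow> B \<subseteq> farey_like Q Q' \<longrightarrow>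
        real (card (quot_set A B)) \<ge>
          real (card A) * real (card B) *
          exp (- (2 * sqrt (ln 2) + \<epsilon> (Q * Q')) * ln (Q * Q') / sqrt (ln (ln (Q * Q')))))"
proof -
  \<comment> \<open>The value solves \<open>p powr - \<delta> x = 1/3\<close> at
    \<open>p = sqrt (ln x)\<close>, the threshold used for \<open>y\<close>.\<close>
  define \<delta> where "\<delta> x = 2 * ln 3 / ln (ln x)" for x :: real
  define \<kappa> where "\<kappa> x = (1 - 2 powr - \<delta> x) / (1 + 2 powr - \<delta> x)" for x
  \<comment> \<open>The two terms of \<open>\<epsilon>\<close> are the losses from \<open>(Q * Q') powr (- 2 * \<delta>)\<close> and from the small
    primes; their total is \<open>O(ln x / ln (ln x))\<close>, so \<open>2 * sqrt (ln 2)\<close> is simply discarded.\<close>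
  define \<epsilon> where "\<epsilon> x = sqrt (ln (ln x)) / ln x * (2 * \<delta> x * ln x - sqrt (ln x) * ln (\<kappa> x))" for x
  \<comment> \<open>The first term is of order \<open>1 / sqrt (ln (ln x))\<close>. In the second,
    \<open>\<kappa> x\<close> decays like a constant over \<open>ln (ln x)\<close>, so
    \<open>- ln (\<kappa> x)\<close> grows like \<open>ln (ln (ln x))\<close>, negligible against
    \<open>sqrt (ln x)\<close>.\<close>
  have "(\<epsilon> \<longlongrightarrow> 0) at_top"
    unfolding \<epsilon>_def \<kappa>_def \<delta>_def by real_asymp
  moreover have "real (card A) * real (card B) *
          exp (- (2 * sqrt (ln 2) + \<epsilon> (Q * Q')) * ln (Q * Q') / sqrt (ln (ln (Q * Q'))))
        \<le> real (card (quot_set A B))"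
    if Q: "1 \<le> Q" "1 \<le> Q'" "Q * Q' > exp 1"
      and sub: "A \<subseteq> farey_like Q Q'" "B \<subseteq> farey_like Q Q'" for Q Q' :: real and A B :: "rat set"
  \<comment> \<open>An infinite set has \<open>card\<close> 0 by convention, so the split makes the
    other case trivial.\<close>
  proof (cases "finite A \<and> finite B")
    case True
    define x where "x = Q * Q'"
    have x0: "0 < x" using Q(3) exp_gt_zero[of "1 :: real"] unfolding x_def by linarith
    have "ln (exp 1) < ln x" using Q(3) x0 unfolding x_def[symmetric] by (subst ln_less_cancel_iff) auto
    then have lnx: "1 < ln x" by simp
    then have lnlnx: "0 < ln (ln x)" by simp
    then have \<delta>: "0 < \<delta> x" by (simp add: \<delta>_def)
    then have c2: "2 powr - \<delta> x < 1" by (simp add: powr_less_one)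
    have \<kappa>: "0 < \<kappa> x" unfolding \<kappa>_def using c2 by (intro divide_pos_pos add_pos_nonneg) auto
    have large: "real p powr - \<delta> x \<le> 1/3" if "prime p" "sqrt (ln x) < real p" for p :: nat
    proof -
      have p: "0 < real p" using prime_gt_0_nat[OF that(1)] by simp
      have "ln (ln x) / 2 = ln (sqrt (ln x))" using lnx by (simp add: ln_sqrt)
      also have "\<dots> \<le> ln (real p)" using that(2) lnx p by simp
      finally have "\<delta> x * (ln (ln x) / 2) \<le> \<delta> x * ln (real p)"
        using \<delta> by (intro mult_left_mono) auto
      then have "ln 3 \<le> \<delta> x * ln (real p)" using lnlnx by (simp add: \<delta>_def)
      then have "real p powr - \<delta> x \<le> exp (- ln 3)" using p by (simp add: powr_def)
      then show ?thesis by (simp add: exp_minus)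
    qed
    have "- (2 * sqrt (ln 2) + \<epsilon> x) * ln x / sqrt (ln (ln x))
        = - (2 * sqrt (ln 2) * ln x / sqrt (ln (ln x))) - \<epsilon> x * ln x / sqrt (ln (ln x))"
      by (simp add: algebra_simps add_divide_distrib diff_divide_distrib)
    also have "\<epsilon> x * ln x / sqrt (ln (ln x)) = 2 * \<delta> x * ln x - sqrt (ln x) * ln (\<kappa> x)"
      using lnx lnlnx by (simp add: \<epsilon>_def)
    also have "- (2 * sqrt (ln 2) * ln x / sqrt (ln (ln x))) - (2 * \<delta> x * ln x - sqrt (ln x) * ln (\<kappa> x))
        \<le> sqrt (ln x) * ln (\<kappa> x) + - 2 * \<delta> x * ln x"
      using lnx lnlnx by simp
    finally have "exp (- (2 * sqrt (ln 2) + \<epsilon> x) * ln x / sqrt (ln (ln x)))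
        \<le> exp (sqrt (ln x) * ln (\<kappa> x) + - 2 * \<delta> x * ln x)" by simp
    also have "\<dots> = \<kappa> x powr sqrt (ln x) * x powr (- 2 * \<delta> x)"
      using \<kappa> x0 unfolding exp_add by (simp add: powr_def)
    finally have "real (card A) * real (card B) * exp (- (2 * sqrt (ln 2) + \<epsilon> x) * ln x / sqrt (ln (ln x)))
        \<le> real (card A) * real (card B) * (\<kappa> x powr sqrt (ln x) * x powr (- 2 * \<delta> x))"
      by (intro mult_left_mono) auto
    also have "\<dots> \<le> real (card (quot_set A B))"
      unfolding x_def
    proof (rule card_quot_set_ge)
      show "\<kappa> (Q * Q') = (1 - 2 powr - \<delta> (Q * Q')) / (1 + 2 powr - \<delta> (Q * Q'))"
        by (simp add: \<kappa>_def)
    qed (use \<delta> lnx large True sub in \<open>auto simp: x_def\<close>)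
    finally show ?thesis by (simp add: x_def)
  qed auto
  ultimately show ?thesis by blast
qed

end
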